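(* Consider a run of AdaSDCA (described in the context). Suppose that at each iteration $t\ge 0$ one has $\min_{i\in I_t}p_i^t>0$ and $\theta(\kappa^t,p^t)\le \min_{i\in I_t}p_i^t$. For $t\ge 0$ define $$\tilde\theta_t := \frac{\mathbb{E}\left[\theta(\kappa^t,p^t)\,(P(w^t)-D(\alpha^t))\right]}{\mathbb{E}\left[P(w^t)-D(\alpha^t)\right]}.$$ Then for every $t\ge 0$ (such that $\mathbb{E}[P(w^k)-D(\alpha^k)]>0$ for $k=0,\dots,t$, so that $\tilde\theta_0,\dots,\tilde\theta_t$ are well defined), $$\mathbb{E}[P(w^t)-D(\alpha^t)]\le \frac{1}{\tilde\theta_t}\prod_{k=0}^{t-1}(1-\tilde\theta_k)\,\bigl(D(\alpha^* )-D(\alpha^0)\bigr),$$ where $\alpha^*$ is a maximizer of $D$ over $\mathbb{R}^n$ and the empty product is $1$.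
   Context: Setting. Let $\lambda,\gamma>0$, $A_1,\dots,A_n\in\mathbb{R}^d$, $A=[A_1,\dots,A_n]\in\mathbb{R}^{d\times n}$. Each $\phi_i:\mathbb{R}\to\mathbb{R}$ is convex and $1/\gamma$-smooth: differentiable with $|\phi_i'(a)-\phi_i'(b)|\le\frac1\gamma|a-b|$ for all $a,b\in\mathbb R$; $\nabla\phi_i$ denotes $\phi_i'$. The function $g:\mathbb{R}^d\to\mathbb{R}$ is $1$-strongly convex with respect to the Euclidean norm. $h^*(u)=\sup_s\{s^\top u-h(s)\}$ is the convex conjugate. Primal and dual functions: $$P(w)=\frac1n\sum_{i=1}^n\phi_i(A_i^\top w)+\lambda g(w),\qquad D(\alpha)=-\lambda g^*\Bigl(\tfrac{1}{\lambda n}\sum_{i=1}^nA_i\alpha_i\Bigr)-\frac1n\sum_{i=1}^n\phi_i^*(-\alpha_i),$$ for $w\in\mathbb{R}^d$, $\alpha\in\mathbb{R}^n$. Put $v_i=A_i^\top A_i$, $[n]=\{1,\dots,n\}$. AdaSDCA. Start from a deterministic $\alpha^0\in\mathbb{R}^n$ with $D(\alpha^0)>-\infty$, and $\bar\alpha^0=\frac{1}{\lambda n}A\alpha^0$. For $t=0,1,2,\dots$: set $w^t=\nabla g^*(\bar\alpha^t)$; compute the dual residue $\kappa_i^t=\alpha_i^t+\nabla\phi_i(A_i^\top w^t)$, $i\in[n]$; choose a probability vector $p^t\in\mathbb{R}^n_+$, $\sum_ip_i^t=1$ (it may depend on the past $i_0,\dots,i_{t-1}$); draw $i_t\in[n]$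 with probabilities $p^t$ (conditionally on the past); compute $$\Delta\alpha^t_{i_t}=\arg\max_{\Delta\in\mathbb{R}}\Bigl\{-\phi_{i_t}^*(-(\alpha^t_{i_t}+\Delta))-A_{i_t}^\top w^t\Delta-\frac{v_{i_t}}{2\lambda n}|\Delta|^2\Bigr\};$$ set $\alpha^{t+1}_{i_t}=\alpha^t_{i_t}+\Delta\alpha^t_{i_t}$, $\alpha^{t+1}_j=\alpha^t_j$ for $j\ne i_t$, and $\bar\alpha^{t+1}=\bar\alpha^t+\frac{\Delta\alpha^t_{i_t}}{\lambda n}A_{i_t}$ (so $\bar\alpha^{t}=\frac{1}{\lambda n}A\alpha^{t}$). Let $I_t=\{i\in[n]:\kappa_i^t\neq0\}$. The function $\theta$ is $$\theta(\kappa,p)=\frac{n\lambda\gamma\sum_{i:\kappa_i\ne0}|\kappa_i|^2}{\sum_{i:\kappa_i\neq0}p_i^{-1}|\kappa_i|^2(v_i+n\lambda\gamma)}.$$ Conventions: $\theta(0,p)=0$; a minimum over the empty set is $+\infty$. $\mathbb{E}$ is the expectation over all random indices. *)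

theory Defs
  imports "HOL-Probability.Probability"
begin

definition smooth_fun :: "real \<Rightarrow> (real \<Rightarrow> real) \<Rightarrow> bool" where
  "smooth_fun L f \<longleftrightarrow> f differentiable_on UNIV \<and> L-lipschitz_on UNIV (deriv f)"

definition strongly_convex :: "real \<Rightarrow> ('a::euclidean_space \<Rightarrow> real) \<Rightarrow> bool" where
  "strongly_convex \<mu> g \<longleftrightarrow>
     (\<forall>x y. \<forall>u\<in>{0..1}.
        g (u *\<^sub>R x + (1 - u) *\<^sub>R y)
          \<le> u * g x + (1 - u) * g y - \<mu> / 2 * u * (1 - u) * (norm (x - y))\<^sup>2)"

definition convex_conjugate :: "('a::euclidean_space \<Rightarrow> real) \<Rightarrow> 'a \<Rightarrow> ereal" where
  "convex_conjugate h u = (SUP s. ereal (s \<bullet> u - h s))"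

text \<open>
  The data vectors are the columns of \<open>A\<close>, so the number of samples is \<open>CARD('n)\<close> and the
  number of features is \<open>CARD('d)\<close>.
\<close>

definition primal ::
  "real^'n^'d \<Rightarrow> ('n \<Rightarrow> real \<Rightarrow> real) \<Rightarrow> (real^'d \<Rightarrow> real) \<Rightarrow> real \<Rightarrow> real^'d \<Rightarrow> real" where
  "primal A \<phi> g lam w =
     (1 / real CARD('n)) * (\<Sum>i\<in>UNIV. \<phi> i (column i A \<bullet> w)) + lam * g w"

text \<open>
  A conjugate of a real-valued function is never \<open>-\<infinity>\<close>, so the sum below never mixes infinities
  of both signs; the conjugate of a strongly convex real-valued \<open>g\<close> is moreover finite.
  Hence \<open>dual\<close> takes values in \<open>[-\<infinity>, \<infinity>)\<close>.
\<close>

definition dual ::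
  "real^'n^'d \<Rightarrow> ('n \<Rightarrow> real \<Rightarrow> real) \<Rightarrow> (real^'d \<Rightarrow> real) \<Rightarrow> real \<Rightarrow> real^'n \<Rightarrow> ereal" where
  "dual A \<phi> g lam \<alpha> =
     - (ereal lam * convex_conjugate g
          ((1 / (lam * real CARD('n))) *\<^sub>R (\<Sum>i\<in>UNIV. (\<alpha> $ i) *\<^sub>R column i A)))
     - ereal (1 / real CARD('n)) * (\<Sum>i\<in>UNIV. convex_conjugate (\<phi> i) (- (\<alpha> $ i)))"

definition sqlen :: "real^'n^'d \<Rightarrow> 'n \<Rightarrow> real" where
  "sqlen A i = column i A \<bullet> column i A"

definition residue ::
  "real^'n^'d \<Rightarrow> ('n \<Rightarrow> real \<Rightarrow> real) \<Rightarrow> real^'n \<Rightarrow> real^'d \<Rightarrow> real^'n" where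
  "residue A \<phi> \<alpha> w = (\<chi> i. \<alpha> $ i + deriv (\<phi> i) (column i A \<bullet> w))"

text \<open>The convention \<open>\<theta>(0, p) = 0\<close> holds because division by zero gives zero.\<close>

definition theta :: "real^'n^'d \<Rightarrow> real \<Rightarrow> real \<Rightarrow> real^'n \<Rightarrow> 'n pmf \<Rightarrow> real" where
  "theta A lam gam \<kappa> p =
     (real CARD('n) * lam * gam * (\<Sum>i | \<kappa> $ i \<noteq> 0. \<bar>\<kappa> $ i\<bar>\<^sup>2)) /
     (\<Sum>i | \<kappa> $ i \<noteq> 0.
        inverse (pmf p i) * \<bar>\<kappa> $ i\<bar>\<^sup>2 * (sqlen A i + real CARD('n) * lam * gam))"

text \<open>The infimum is a minimum over a finite set, and it is \<open>\<infinity>\<close> if the set is empty.\<close>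

definition min_prob :: "real^'n \<Rightarrow> 'n pmf \<Rightarrow> ereal" where
  "min_prob \<kappa> p = (INF i\<in>{i. \<kappa> $ i \<noteq> 0}. ereal (pmf p i))"

text \<open>
  All quantities of iteration \<open>t\<close> are functions of the list of indices drawn so far,
  \<open>[i\<^sub>0, \<dots>, i\<^sub>t\<^sub>-\<^sub>1]\<close>. A sampling rule \<open>p\<close> maps this list to the distribution of the next index;
  \<open>past p t\<close> is the resulting distribution of the list at iteration \<open>t\<close>, and its support
  consists of the histories that occur with positive probability.
\<close>

primrec past :: "('n list \<Rightarrow> 'n pmf) \<Rightarrow> nat \<Rightarrow> 'n list pmf" where
  "past p 0 = return_pmf []"
| "past p (Suc t) = bind_pmf (past p t) (\<lambda>h. map_pmf (\<lambda>i. h @ [i]) (p h))"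

definition coord_objective ::
  "real^'n^'d \<Rightarrow> ('n \<Rightarrow> real \<Rightarrow> real) \<Rightarrow> real \<Rightarrow> real^'n \<Rightarrow> real^'d \<Rightarrow> 'n \<Rightarrow> real \<Rightarrow> ereal" where
  "coord_objective A \<phi> lam \<alpha> w i \<Delta> =
     - convex_conjugate (\<phi> i) (- (\<alpha> $ i + \<Delta>))
     - ereal ((column i A \<bullet> w) * \<Delta>)
     - ereal (sqlen A i / (2 * lam * real CARD('n)) * \<bar>\<Delta>\<bar>\<^sup>2)"

text \<open>
  \<open>\<alpha>\<close>, \<open>abar\<close> and \<open>w\<close> give the iterates after a history \<open>h\<close>; they are constrained only on
  histories of positive probability.
\<close>

definition adasdca_run ::
  "real^'n^'d \<Rightarrow> ('n \<Rightarrow> real \<Rightarrow> real) \<Rightarrow> (real^'d \<Rightarrow> real) \<Rightarrow> real \<Rightarrow> real^'n \<Rightarrow>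
   ('n list \<Rightarrow> 'n pmf) \<Rightarrow> ('n list \<Rightarrow> real^'n) \<Rightarrow> ('n list \<Rightarrow> real^'d) \<Rightarrow> ('n list \<Rightarrow> real^'d) \<Rightarrow> bool"
where
  "adasdca_run A \<phi> g lam \<alpha>0 p \<alpha> abar w \<longleftrightarrow>
     \<alpha> [] = \<alpha>0 \<and>
     abar [] = (1 / (lam * real CARD('n))) *\<^sub>R (A *v \<alpha>0) \<and>
     (\<forall>t. \<forall>h\<in>set_pmf (past p t).
        GDERIV (\<lambda>u. real_of_ereal (convex_conjugate g u)) (abar h) :> w h \<and>
        (\<forall>i\<in>set_pmf (p h). \<exists>\<Delta>.
           is_arg_max (coord_objective A \<phi> lam (\<alpha> h) (w h) i) (\<lambda>_. True) \<Delta> \<and>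
           \<alpha> (h @ [i]) = (\<chi> j. if j = i then \<alpha> h $ i + \<Delta> else \<alpha> h $ j) \<and>
           abar (h @ [i]) = abar h + (\<Delta> / (lam * real CARD('n))) *\<^sub>R column i A))"

text \<open>
  Along a run started from a point with finite dual value the dual values stay finite, so
  \<open>real_of_ereal\<close> loses nothing.
\<close>

definition gap ::
  "real^'n^'d \<Rightarrow> ('n \<Rightarrow> real \<Rightarrow> real) \<Rightarrow> (real^'d \<Rightarrow> real) \<Rightarrow> real \<Rightarrow> real^'n \<Rightarrow> real^'d \<Rightarrow> real" where
  "gap A \<phi> g lam \<alpha> w = primal A \<phi> g lam w - real_of_ereal (dual A \<phi> g lam \<alpha>)"

definition expected_gap ::
  "real^'n^'d \<Rightarrow> ('n \<Rightarrow> real \<Rightarrow> real) \<Rightarrow> (real^'d \<Rightarrow> real) \<Rightarrow> real \<Rightarrow>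
   ('n list \<Rightarrow> 'n pmf) \<Rightarrow> ('n list \<Rightarrow> real^'n) \<Rightarrow> ('n list \<Rightarrow> real^'d) \<Rightarrow> nat \<Rightarrow> real" where
  "expected_gap A \<phi> g lam p \<alpha> w t =
     measure_pmf.expectation (past p t) (\<lambda>h. gap A \<phi> g lam (\<alpha> h) (w h))"

definition theta_tilde ::
  "real^'n^'d \<Rightarrow> ('n \<Rightarrow> real \<Rightarrow> real) \<Rightarrow> (real^'d \<Rightarrow> real) \<Rightarrow> real \<Rightarrow> real \<Rightarrow>
   ('n list \<Rightarrow> 'n pmf) \<Rightarrow> ('n list \<Rightarrow> real^'n) \<Rightarrow> ('n list \<Rightarrow> real^'d) \<Rightarrow> nat \<Rightarrow> real" where
  "theta_tilde A \<phi> g lam gam p \<alpha> w t =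
     measure_pmf.expectation (past p t)
       (\<lambda>h. theta A lam gam (residue A \<phi> (\<alpha> h) (w h)) (p h) * gap A \<phi> g lam (\<alpha> h) (w h))
     / expected_gap A \<phi> g lam p \<alpha> w t"

end

theory Submission
  imports Defs
begin

text \<open>
  Strong convexity of \<open>g\<close> makes \<open>g\<^sup>*\<close> smooth, and smoothness of \<open>\<phi>\<^sub>i\<close> makes
  \<open>\<phi>\<^sub>i\<^sup>*\<close> strongly convex. Comparing the coordinate maximiser with the trial step
  \<open>- s\<^sub>i \<kappa>\<^sub>i\<close>, where \<open>s\<^sub>i = \<theta> / p\<^sub>i \<le> 1\<close>, bounds the dual increase from below by
  \<open>s\<^sub>i\<close> times the Fenchel--Young gap of coordinate \<open>i\<close> plus a quadratic term. In
  expectation the gaps add up to \<open>\<theta>\<close> times the duality gap, and \<open>\<theta>\<close> is exactly the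
  value for which the quadratic terms cancel. Hence
  \<open>E[D\<^sub>t\<^sub>+\<^sub>1] - E[D\<^sub>t] \<ge> E[\<theta>\<^sub>t (P\<^sub>t - D\<^sub>t)]\<close>, which with weak duality contracts the dual
  suboptimality by \<open>1 - \<theta>\<close>-tilde in every step and, since \<open>E[D\<^sub>t\<^sub>+\<^sub>1] \<le> D\<^sup>*\<close>, bounds the
  duality gap by the suboptimality.
\<close>

section \<open>Convex conjugates of smooth and of strongly convex functions\<close>

text \<open>The descent lemma. The error \<open>h\<close> of the quadratic model along the segment
  from \<open>b\<close> to \<open>b + c\<close> has nonpositive derivative, because
  \<open>deriv f\<close> is Lipschitz.\<close>

lemma smooth_fun_upper_quadratic:
  assumes "smooth_fun L f"
  shows "f (b + c) \<le> f b + deriv f b * c + L / 2 * c\<^sup>2"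
proof -
  have D: "(f has_field_derivative deriv f x) (at x)" for x
    using assms by (auto simp: smooth_fun_def differentiable_on_def
        DERIV_deriv_iff_real_differentiable)
  have lip: "\<bar>deriv f x - deriv f y\<bar> \<le> L * \<bar>x - y\<bar>" for x y
    using assms by (auto simp: smooth_fun_def lipschitz_on_def dist_real_def)
  define h where "h s = f (b + s * c) - s * c * deriv f b - L / 2 * s\<^sup>2 * c\<^sup>2" for s
  have "h 1 \<le> h 0"
  proof (rule DERIV_nonpos_imp_nonincreasing[where f = h])
    fix s :: real assume s: "0 \<le> s" "s \<le> 1"
    have "(h has_field_derivative
        (deriv f (b + s * c) * c - c * deriv f b - L * s * c\<^sup>2)) (at s)"
      unfolding h_def
      by (rule derivative_eq_intros DERIV_chain2[OF D] refl | simp)+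
    moreover have "(deriv f (b + s * c) - deriv f b) * c \<le> L * s * c\<^sup>2"
    proof -
      have "(deriv f (b + s * c) - deriv f b) * c \<le> \<bar>deriv f (b + s * c) - deriv f b\<bar> * \<bar>c\<bar>"
        by (metis abs_ge_self abs_mult)
      also have "\<dots> \<le> (L * \<bar>(b + s * c) - b\<bar>) * \<bar>c\<bar>"
        by (intro mult_right_mono lip) auto
      also have "\<dots> = L * s * c\<^sup>2"
        using s by (simp add: abs_mult power2_eq_square)
      finally show ?thesis .
    qed
    ultimately show "\<exists>y. (h has_field_derivative y) (at s) \<and> y \<le> 0"
      by (intro exI[of _ "deriv f (b + s * c) * c - c * deriv f b - L * s * c\<^sup>2"])
        (simp add: algebra_simps)
  qed simp
  then show ?thesis by (simp add: h_def algebra_simps)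
qed

section \<open>The Fenchel-Young inequality and its equality case\<close>

lemma convex_conjugate_ge: "ereal (s \<bullet> u - h s) \<le> convex_conjugate h u"
  unfolding convex_conjugate_def by (rule SUP_upper) simp

lemma convex_conjugate_le:
  "(\<And>s. s \<bullet> u - h s \<le> c) \<Longrightarrow> convex_conjugate h u \<le> ereal c"
  unfolding convex_conjugate_def by (rule SUP_least) simp

lemma convex_conjugate_neq_MInf: "convex_conjugate h u \<noteq> -\<infinity>"
  using convex_conjugate_ge[of 0 u h] by auto

lemma Fenchel_Young: "convex_conjugate h u = ereal r \<Longrightarrow> s \<bullet> u \<le> h s + r"
  using convex_conjugate_ge[of s u h] by simp

text \<open>Equality in Fenchel-Young: a convex function lies above its tangent at \<open>a\<close>,
  so \<open>a\<close> attains the supremum.\<close>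

lemma convex_conjugate_deriv:
  assumes "convex_on UNIV f" "smooth_fun L f"
  shows "convex_conjugate f (deriv f a) = ereal (a * deriv f a - f a)"
proof (rule antisym)
  show "convex_conjugate f (deriv f a) \<le> ereal (a * deriv f a - f a)"
  proof (rule convex_conjugate_le)
    fix s
    have "(f has_field_derivative deriv f a) (at a)"
      using assms(2) by (auto simp: smooth_fun_def differentiable_on_def
          DERIV_deriv_iff_real_differentiable)
    then have "f s - f a \<ge> deriv f a * (s - a)"
      using convex_on_imp_above_tangent[OF assms(1), of a s "deriv f a"] by simp
    then show "s \<bullet> deriv f a - f s \<le> a * deriv f a - f a"
      by (simp add: algebra_simps)
  qed
qed (use convex_conjugate_ge[of a "deriv f a" f] in simp)

text \<open>For each \<open>b\<close>, Fenchel-Young is applied to \<open>x\<close> and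
  \<open>y\<close> at two points shifted from \<open>b\<close> in opposite directions; the descent
  lemma bounds \<open>f\<close> there, and the two bounds are averaged with weights
  \<open>1 - s\<close> and \<open>s\<close>.\<close>

lemma smooth_fun_conjugate_strongly_convex:
  fixes f :: "real \<Rightarrow> real"
  assumes "smooth_fun (1 / c) f" "c > 0" "s \<in> {0..1}"
    and X: "convex_conjugate f x = ereal X" and Y: "convex_conjugate f y = ereal Y"
  shows "convex_conjugate f ((1 - s) * x + s * y)
    \<le> ereal ((1 - s) * X + s * Y - c / 2 * s * (1 - s) * (x - y)\<^sup>2)"
proof (rule convex_conjugate_le)
  fix b
  \<comment> \<open>The shifts average out to zero, so the first-order terms cancel; \<open>\<delta>\<close> maximises the
    remaining quadratic.\<close>
  define \<delta> where "\<delta> = c * (x - y)"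
  define q1 where "q1 = (s * \<delta>)\<^sup>2 / (2 * c)"
  define q2 where "q2 = ((1 - s) * \<delta>)\<^sup>2 / (2 * c)"
  define K where "K = c / 2 * s * (1 - s) * (x - y)\<^sup>2"
  have up: "f (b + d) \<le> f b + deriv f b * d + d\<^sup>2 / (2 * c)" for d
    using smooth_fun_upper_quadratic[OF assms(1), of b d] by (simp add: field_simps)
  have 1: "(b + s * \<delta>) * x \<le> f b + deriv f b * (s * \<delta>) + q1 + X"
    using Fenchel_Young[OF X, of "b + s * \<delta>"] up[of "s * \<delta>"] by (simp add: q1_def)
  have 2: "(b - (1 - s) * \<delta>) * y \<le> f b - deriv f b * ((1 - s) * \<delta>) + q2 + Y"
    using Fenchel_Young[OF Y, of "b - (1 - s) * \<delta>"] up[of "- ((1 - s) * \<delta>)"]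
    by (simp add: q2_def)
  have "(1 - s) * ((b + s * \<delta>) * x) + s * ((b - (1 - s) * \<delta>) * y)
     \<le> (1 - s) * (f b + deriv f b * (s * \<delta>) + q1 + X)
      + s * (f b - deriv f b * ((1 - s) * \<delta>) + q2 + Y)"
    using assms(3) by (intro add_mono mult_left_mono 1 2) auto
  moreover have "(1 - s) * q1 + s * q2 = K"
  proof -
    have "(1 - s) * q1 + s * q2 = s * (1 - s) * \<delta>\<^sup>2 / (2 * c)"
      using assms(2) unfolding q1_def q2_def by (simp add: field_simps power2_eq_square)
    then show ?thesis
      using assms(2) by (simp add: \<delta>_def K_def power2_eq_square)
  qed
  \<comment> \<open>The shifts gain \<open>2 * K\<close> in the pairings, while smoothness costs
    only \<open>K\<close>; the surplus \<open>K\<close> is the strong convexity term.\<close>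
  moreover have "(1 - s) * (s * \<delta> * x) - s * ((1 - s) * \<delta> * y) = 2 * K"
    unfolding \<delta>_def K_def by (simp add: field_simps power2_eq_square)
  moreover have "(1 - s) * ((b + s * \<delta>) * x) + s * ((b - (1 - s) * \<delta>) * y)
      = b * ((1 - s) * x + s * y) + ((1 - s) * (s * \<delta> * x) - s * ((1 - s) * \<delta> * y))"
    by (simp add: algebra_simps)
  moreover have "(1 - s) * (f b + deriv f b * (s * \<delta>) + q1 + X)
      + s * (f b - deriv f b * ((1 - s) * \<delta>) + q2 + Y)
      = f b + ((1 - s) * q1 + s * q2) + (1 - s) * X + s * Y"
    by (simp add: algebra_simps)
  ultimately show "b \<bullet> ((1 - s) * x + s * y) - f b
      \<le> (1 - s) * X + s * Y - c / 2 * s * (1 - s) * (x - y)\<^sup>2"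
    unfolding K_def[symmetric] inner_real_def by linarith
qed

section \<open>Minimisers of strongly convex functions and smoothness of the conjugate\<close>

lemma strongly_convex_diff_inner:
  assumes "strongly_convex \<mu> g"
  shows "strongly_convex \<mu> (\<lambda>x. g x - x \<bullet> u)"
  unfolding strongly_convex_def
proof (intro allI ballI)
  fix x y :: 'a and v :: real
  assume "v \<in> {0..1}"
  then have "g (v *\<^sub>R x + (1 - v) *\<^sub>R y)
      \<le> v * g x + (1 - v) * g y - \<mu> / 2 * v * (1 - v) * (norm (x - y))\<^sup>2"
    using assms unfolding strongly_convex_def by blast
  then show "g (v *\<^sub>R x + (1 - v) *\<^sub>R y) - (v *\<^sub>R x + (1 - v) *\<^sub>R y) \<bullet> u
      \<le> v * (g x - x \<bullet> u) + (1 - v) * (g y - y \<bullet> u)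
        - \<mu> / 2 * v * (1 - v) * (norm (x - y))\<^sup>2"
    by (simp add: algebra_simps)
qed

lemma strongly_convex_continuous:
  fixes g :: "'a::euclidean_space \<Rightarrow> real"
  assumes "strongly_convex \<mu> g" "\<mu> \<ge> 0"
  shows "continuous_on UNIV g"
proof (rule convex_on_continuous[OF open_UNIV], rule convex_onI)
  fix t :: real and x y :: 'a
  assume t: "0 < t" "t < 1"
  then have "g (t *\<^sub>R y + (1 - t) *\<^sub>R x)
      \<le> t * g y + (1 - t) * g x - \<mu> / 2 * t * (1 - t) * (norm (y - x))\<^sup>2"
    using assms(1) unfolding strongly_convex_def by simp
  moreover have "0 \<le> \<mu> / 2 * t * (1 - t) * (norm (y - x))\<^sup>2"
    using t assms(2) by simp
  ultimately show "g ((1 - t) *\<^sub>R x + t *\<^sub>R y) \<le> (1 - t) * g x + t * g y"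
    by (simp add: add.commute)
qed simp

text \<open>Coercivity: comparing \<open>x\<close> with 0 and with its projection to the unit sphere
  shows that no point outside a large ball beats 0, so a minimiser on that ball is global.\<close>

lemma strongly_convex_has_minimizer:
  fixes g :: "'a::euclidean_space \<Rightarrow> real"
  assumes g: "strongly_convex \<mu> g" and \<mu>: "\<mu> > 0"
  obtains s where "\<And>x. g x \<ge> g s"
proof -
  have cont: "continuous_on S g" for S
    using strongly_convex_continuous[OF g] \<mu> continuous_on_subset by force
  obtain m where m: "\<And>x. norm x = 1 \<Longrightarrow> m \<le> g x"
  proof -
    have "bounded (g ` sphere 0 1)"
      by (intro compact_imp_bounded compact_continuous_image cont compact_sphere)
    then obtain B where "\<And>x. norm x = 1 \<Longrightarrow> \<bar>g x\<bar> \<le> B"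
      by (force simp: bounded_iff)
    then show ?thesis by (intro that[of "- B"]) (metis abs_le_D2 minus_le_iff)
  qed
  \<comment> \<open>Beyond \<open>R\<close> the strong convexity term
    \<open>\<mu> / 2 * (r - 1)\<close> outweighs \<open>\<bar>m\<bar> + \<bar>g 0\<bar>\<close>; the
    maximum with 1 makes \<open>1 / r\<close> a convex weight.\<close>
  define R where "R = max 1 (1 + 2 / \<mu> * (\<bar>m\<bar> + \<bar>g 0\<bar>))"
  have far: "g x \<ge> g 0" if x: "norm x > R" for x
  proof -
    define r where "r = norm x"
    have r: "r > 1" and r2: "2 / \<mu> * (\<bar>m\<bar> + \<bar>g 0\<bar>) \<le> r - 1"
      using x by (auto simp: r_def R_def)
    have "m \<le> g ((1 / r) *\<^sub>R x + (1 - 1 / r) *\<^sub>R 0)"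
      using r by (intro m) (auto simp: r_def)
    also have "\<dots> \<le> 1 / r * g x + (1 - 1 / r) * g 0
        - \<mu> / 2 * (1 / r) * (1 - 1 / r) * (norm (x - 0))\<^sup>2"
      using g[unfolded strongly_convex_def, rule_format, of "1 / r" x 0] r by simp
    also have "\<dots> = 1 / r * (g x - g 0) + g 0 - \<mu> / 2 * (r - 1)"
      using r by (simp add: r_def[symmetric] field_simps power2_eq_square)
    finally have "1 / r * (g x - g 0) \<ge> m - g 0 + \<mu> / 2 * (r - 1)" by simp
    moreover have "\<mu> / 2 * (r - 1) \<ge> \<bar>m\<bar> + \<bar>g 0\<bar>"
      using r2 \<mu> by (simp add: field_simps)
    ultimately have "1 / r * (g x - g 0) \<ge> 0" by linarith
    then show ?thesis using r by (simp add: zero_le_divide_iff)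
  qed
  have "R \<ge> 0" by (simp add: R_def)
  then obtain s where s: "s \<in> cball 0 R" "\<forall>x\<in>cball 0 R. g s \<le> g x"
    using continuous_attains_inf[OF compact_cball _ cont, of 0 R] by auto
  have "g s \<le> g 0" using s \<open>R \<ge> 0\<close> by simp
  then show thesis
    using s far by (intro that[of s]) (metis dual_order.trans linorder_le_less_linear
        mem_cball_0)
qed

text \<open>No derivative of \<open>g\<close> is available, so minimality is tested at points
  between \<open>x\<close> and \<open>s\<close>; dividing by \<open>1 - z\<close> and letting
  \<open>z\<close> tend to 1 gives the growth.\<close>

lemma strongly_convex_minimizer_growth:
  assumes g: "strongly_convex \<mu> g" and min: "\<And>x. g x \<ge> g s"
  shows "g x \<ge> g s + \<mu> / 2 * (norm (x - s))\<^sup>2"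
proof -
  have "\<mu> / 2 * (norm (x - s))\<^sup>2 \<le> g x - g s"
  proof (rule field_le_mult_one_interval)
    fix z :: real assume z: "0 < z" "z < 1"
    have "g s \<le> g ((1 - z) *\<^sub>R x + (1 - (1 - z)) *\<^sub>R s)" by (rule min)
    also have "\<dots> \<le> (1 - z) * g x + (1 - (1 - z)) * g s
        - \<mu> / 2 * (1 - z) * (1 - (1 - z)) * (norm (x - s))\<^sup>2"
      using z by (intro g[unfolded strongly_convex_def, rule_format]) simp
    finally have "(1 - z) * (z * (\<mu> / 2 * (norm (x - s))\<^sup>2)) \<le> (1 - z) * (g x - g s)"
      by (simp add: algebra_simps)
    then show "z * (\<mu> / 2 * (norm (x - s))\<^sup>2) \<le> g x - g s"
      using z by simp
  qed
  then show ?thesis by simp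
qed

text \<open>Here \<open>s\<close> attains the supremum at \<open>u\<close>. Quadratic growth away
  from \<open>s\<close> limits how much the supremum can rise when \<open>u\<close> moves by
  \<open>d\<close>.\<close>

lemma strongly_convex_conjugate_smooth:
  assumes "strongly_convex 1 g"
  obtains s where "convex_conjugate g u = ereal (s \<bullet> u - g s)"
    and "\<And>d. convex_conjugate g (u + d) \<le> ereal (s \<bullet> u - g s + s \<bullet> d + (norm d)\<^sup>2 / 2)"
proof -
  note sc = strongly_convex_diff_inner[OF assms, of u]
  obtain s where s: "\<And>x. g x - x \<bullet> u \<ge> g s - s \<bullet> u"
    using strongly_convex_has_minimizer[OF sc] by auto
  have grow: "g x - x \<bullet> u \<ge> g s - s \<bullet> u + (norm (x - s))\<^sup>2 / 2" for x
    using strongly_convex_minimizer_growth[OF sc s, of x] by simp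
  have up: "convex_conjugate g (u + d) \<le> ereal (s \<bullet> u - g s + s \<bullet> d + (norm d)\<^sup>2 / 2)" for d
  proof (rule convex_conjugate_le)
    fix x
    \<comment> \<open>Young's inequality, balanced so that its term in \<open>x - s\<close> is
      exactly what the growth at modulus 1 pays for.\<close>
    have "0 \<le> (norm (x - s - d))\<^sup>2" by simp
    also have "\<dots> = (norm (x - s))\<^sup>2 - 2 * ((x - s) \<bullet> d) + (norm d)\<^sup>2"
      by (simp add: power2_norm_eq_inner algebra_simps inner_commute)
    finally have "(x - s) \<bullet> d \<le> (norm (x - s))\<^sup>2 / 2 + (norm d)\<^sup>2 / 2" by simp
    with grow[of x] show "x \<bullet> (u + d) - g x \<le> s \<bullet> u - g s + s \<bullet> d + (norm d)\<^sup>2 / 2"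
      by (simp add: algebra_simps)
  qed
  from up[of 0] have "convex_conjugate g u = ereal (s \<bullet> u - g s)"
    by (intro antisym convex_conjugate_ge) simp
  with up show thesis by (rule that[rotated])
qed

text \<open>Identifies the maximiser \<open>s\<close> with the gradient \<open>w\<close>: by
  Fenchel-Young, with equality at \<open>u\<close>, the map
  \<open>\<lambda>v. G v - v \<bullet> s\<close> is minimal at \<open>u\<close>, so its derivative
  there vanishes.\<close>

lemma strongly_convex_conjugate_gradient:
  assumes "strongly_convex 1 g"
    and w: "GDERIV (\<lambda>u. real_of_ereal (convex_conjugate g u)) u :> w"
  shows "convex_conjugate g u = ereal (w \<bullet> u - g w)"
    and "convex_conjugate g (u + d) \<le> ereal (w \<bullet> u - g w + w \<bullet> d + (norm d)\<^sup>2 / 2)"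
proof -
  obtain s where s: "convex_conjugate g u = ereal (s \<bullet> u - g s)"
    and up: "\<And>d. convex_conjugate g (u + d) \<le> ereal (s \<bullet> u - g s + s \<bullet> d + (norm d)\<^sup>2 / 2)"
    using strongly_convex_conjugate_smooth[OF assms(1), of u] by blast
  define G where "G u = real_of_ereal (convex_conjugate g u)" for u
  have fin: "convex_conjugate g v = ereal (G v)" for v
    using strongly_convex_conjugate_smooth[OF assms(1), of v]
    by (metis G_def real_of_ereal.simps(1))
  have "(\<lambda>h. h \<bullet> (w - s)) = (\<lambda>h. 0)"
  proof (rule differential_zero_maxmin[of u UNIV "\<lambda>v. G v - v \<bullet> s"])
    have "GDERIV G u :> w" using w by (simp add: G_def[abs_def])
    then show "((\<lambda>v. G v - v \<bullet> s) has_derivative (\<lambda>h. h \<bullet> (w - s))) (at u)"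
      unfolding gderiv_def by (auto intro!: derivative_eq_intros simp: inner_diff_right)
    have "G u - u \<bullet> s \<le> G v - v \<bullet> s" for v
      using Fenchel_Young[OF fin[of v], of s] s fin[of u] by (simp add: inner_commute)
    then show "(\<forall>v\<in>UNIV. G v - v \<bullet> s \<le> G u - u \<bullet> s) \<or> (\<forall>v\<in>UNIV. G u - u \<bullet> s \<le> G v - v \<bullet> s)"
      by blast
  qed auto
  then have "(w - s) \<bullet> (w - s) = 0" by meson
  then have "w = s" by simp
  with s up show "convex_conjugate g u = ereal (w \<bullet> u - g w)"
    and "convex_conjugate g (u + d) \<le> ereal (w \<bullet> u - g w + w \<bullet> d + (norm d)\<^sup>2 / 2)"
    by auto
qed

section \<open>Increase of the dual objective\<close>

locale dual_ascent =
  fixes A :: "real^'n^'d"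
    and \<phi> :: "'n \<Rightarrow> real \<Rightarrow> real"
    and g :: "real^'d \<Rightarrow> real"
    and lam gam :: real
  assumes lam: "lam > 0" and gam: "gam > 0"
    and convex: "\<And>i. convex_on UNIV (\<phi> i)"
    and smooth: "\<And>i. smooth_fun (1 / gam) (\<phi> i)"
    and strongly_convex: "strongly_convex 1 g"
begin

section \<open>Real-valued dual objective and the duality gap by coordinates\<close>

definition dual_point :: "real^'n \<Rightarrow> real^'d" where
  "dual_point \<alpha> = (1 / (lam * real CARD('n))) *\<^sub>R (\<Sum>i\<in>UNIV. (\<alpha> $ i) *\<^sub>R column i A)"

definition conj_g :: "real^'d \<Rightarrow> real" where
  "conj_g u = real_of_ereal (convex_conjugate g u)"

definition conj_\<phi> :: "'n \<Rightarrow> real \<Rightarrow> real" where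
  "conj_\<phi> i x = real_of_ereal (convex_conjugate (\<phi> i) x)"

text \<open>The effective domain of the dual: the conjugate of \<open>g\<close> is finite
  everywhere, so only the conjugates of the \<open>\<phi> i\<close> can spoil finiteness.\<close>

definition feasible :: "real^'n \<Rightarrow> bool" where
  "feasible \<alpha> \<longleftrightarrow> (\<forall>i. convex_conjugate (\<phi> i) (- (\<alpha> $ i)) \<noteq> \<infinity>)"

definition dual_real :: "real^'n \<Rightarrow> real" where
  "dual_real \<alpha> = real_of_ereal (dual A \<phi> g lam \<alpha>)"

text \<open>The Fenchel-Young gap of \<open>\<phi> i\<close> at the pair
  \<open>column i A \<bullet> w\<close> and \<open>- (\<alpha> $ i)\<close>.\<close>

definition coord_gap :: "real^'n \<Rightarrow> real^'d \<Rightarrow> 'n \<Rightarrow> real" where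
  "coord_gap \<alpha> w i =
     \<phi> i (column i A \<bullet> w) + conj_\<phi> i (- (\<alpha> $ i)) + \<alpha> $ i * (column i A \<bullet> w)"

lemma conj_g: "convex_conjugate g u = ereal (conj_g u)"
  unfolding conj_g_def
  using strongly_convex_conjugate_smooth[OF strongly_convex, of u]
  by (metis real_of_ereal.simps(1))

lemma conj_\<phi>: "convex_conjugate (\<phi> i) x \<noteq> \<infinity> \<Longrightarrow> convex_conjugate (\<phi> i) x = ereal (conj_\<phi> i x)"
  unfolding conj_\<phi>_def using convex_conjugate_neq_MInf[of "\<phi> i" x]
  by (cases "convex_conjugate (\<phi> i) x") auto

lemma feasible_conj_\<phi>:
  "feasible \<alpha> \<Longrightarrow> convex_conjugate (\<phi> i) (- (\<alpha> $ i)) = ereal (conj_\<phi> i (- (\<alpha> $ i)))"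
  by (simp add: feasible_def conj_\<phi>)

lemma dual_eq:
  assumes "feasible \<alpha>"
  shows "dual A \<phi> g lam \<alpha> = ereal (- (lam * conj_g (dual_point \<alpha>))
    - (\<Sum>i\<in>UNIV. conj_\<phi> i (- (\<alpha> $ i))) / real CARD('n))"
  unfolding dual_def dual_point_def[symmetric] conj_g
  by (simp add: feasible_conj_\<phi>[OF assms])

lemma dual_real_eq:
  assumes "feasible \<alpha>"
  shows "dual_real \<alpha> = - (lam * conj_g (dual_point \<alpha>))
    - (\<Sum>i\<in>UNIV. conj_\<phi> i (- (\<alpha> $ i))) / real CARD('n)"
  unfolding dual_real_def dual_eq[OF assms] by simp

lemma feasible_if_dual_finite:
  assumes "dual A \<phi> g lam \<alpha> > -\<infinity>"
  shows "feasible \<alpha>"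
proof (rule ccontr)
  assume "\<not> feasible \<alpha>"
  then have "(\<Sum>i\<in>UNIV. convex_conjugate (\<phi> i) (- (\<alpha> $ i))) = \<infinity>"
    by (auto simp: feasible_def sum_Pinfty)
  then have "dual A \<phi> g lam \<alpha> = -\<infinity>"
    unfolding dual_def dual_point_def[symmetric] conj_g by simp
  with assms show False by simp
qed

text \<open>Makes the pairing of the Fenchel-Young gap of \<open>g\<close> cancel against those of
  the coordinate gaps.\<close>

lemma inner_dual_point:
  "lam * (w \<bullet> dual_point \<alpha>) = (\<Sum>i\<in>UNIV. \<alpha> $ i * (column i A \<bullet> w)) / real CARD('n)"
  using lam by (simp add: dual_point_def inner_sum_right inner_commute)

lemma coord_gap_nonneg: "feasible \<alpha> \<Longrightarrow> coord_gap \<alpha> w i \<ge> 0"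
  using Fenchel_Young[OF feasible_conj_\<phi>, of \<alpha> "column i A \<bullet> w" i]
  by (simp add: coord_gap_def mult.commute)

lemma coord_gap_eq_0:
  assumes "residue A \<phi> \<alpha> w $ i = 0"
  shows "coord_gap \<alpha> w i = 0"
proof -
  have "\<alpha> $ i = - deriv (\<phi> i) (column i A \<bullet> w)"
    using assms by (simp add: residue_def)
  then show ?thesis
    using convex_conjugate_deriv[OF convex smooth, of i "column i A \<bullet> w"]
    by (simp add: coord_gap_def conj_\<phi>_def)
qed

text \<open>Primal minus dual is the mean of the coordinate gaps plus \<open>lam\<close> times the
  Fenchel-Young gap of \<open>g\<close>, all nonnegative.\<close>

lemma weak_duality:
  assumes "feasible \<alpha>"
  shows "dual_real \<alpha> \<le> primal A \<phi> g lam w"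
proof -
  have "0 \<le> (\<Sum>i\<in>UNIV. coord_gap \<alpha> w i) / real CARD('n)"
    using coord_gap_nonneg[OF assms] by (simp add: sum_nonneg)
  moreover have "lam * (w \<bullet> dual_point \<alpha>) \<le> lam * (g w + conj_g (dual_point \<alpha>))"
    using Fenchel_Young[OF conj_g] lam by (intro mult_left_mono) auto
  ultimately show ?thesis
    unfolding inner_dual_point
    by (simp add: dual_real_eq[OF assms] primal_def coord_gap_def sum.distrib
        add_divide_distrib algebra_simps)
qed

text \<open>At the gradient point \<open>w\<close> Fenchel-Young for \<open>g\<close> is an
  equality, so only the coordinate gaps remain.\<close>

lemma gap_eq:
  assumes "feasible \<alpha>"
    and w: "GDERIV (\<lambda>u. real_of_ereal (convex_conjugate g u)) (dual_point \<alpha>) :> w"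
  shows "gap A \<phi> g lam \<alpha> w = (\<Sum>i\<in>UNIV. coord_gap \<alpha> w i) / real CARD('n)"
proof -
  have "conj_g (dual_point \<alpha>) = w \<bullet> dual_point \<alpha> - g w"
    using strongly_convex_conjugate_gradient(1)[OF strongly_convex w] by (simp add: conj_g_def)
  then have "lam * conj_g (dual_point \<alpha>)
      = (\<Sum>i\<in>UNIV. \<alpha> $ i * (column i A \<bullet> w)) / real CARD('n) - lam * g w"
    by (simp add: right_diff_distrib inner_dual_point)
  then show ?thesis
    unfolding gap_def dual_real_def[symmetric] dual_real_eq[OF assms(1)]
    by (simp add: primal_def coord_gap_def sum.distrib add_divide_distrib)
qed

section \<open>Effect of a single coordinate step\<close>

definition coord_update :: "real^'n \<Rightarrow> 'n \<Rightarrow> real \<Rightarrow> real^'n" where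
  "coord_update \<alpha> i \<Delta> = (\<chi> j. if j = i then \<alpha> $ i + \<Delta> else \<alpha> $ j)"

lemma sum_coord_update:
  fixes f :: "'n \<Rightarrow> real \<Rightarrow> 'a::ab_group_add"
  shows "(\<Sum>j\<in>UNIV. f j (coord_update \<alpha> i \<Delta> $ j))
    = (\<Sum>j\<in>UNIV. f j (\<alpha> $ j)) + (f i (\<alpha> $ i + \<Delta>) - f i (\<alpha> $ i))"
proof -
  have "(\<Sum>j\<in>UNIV. f j (coord_update \<alpha> i \<Delta> $ j))
      = f i (\<alpha> $ i + \<Delta>) + (\<Sum>j\<in>UNIV - {i}. f j (\<alpha> $ j))"
    by (subst sum.remove[of _ i]) (auto simp: coord_update_def)
  moreover have "(\<Sum>j\<in>UNIV. f j (\<alpha> $ j)) = f i (\<alpha> $ i) + (\<Sum>j\<in>UNIV - {i}. f j (\<alpha> $ j))"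
    by (subst sum.remove[of _ i]) auto
  ultimately show ?thesis by simp
qed

lemma dual_point_coord_update:
  "dual_point (coord_update \<alpha> i \<Delta>)
    = dual_point \<alpha> + (\<Delta> / (lam * real CARD('n))) *\<^sub>R column i A"
  unfolding dual_point_def
  using sum_coord_update[of "\<lambda>j x. x *\<^sub>R column j A" \<alpha> i \<Delta>]
  by (simp add: algebra_simps)

lemma coord_objective_finite:
  assumes "convex_conjugate (\<phi> i) (- (\<alpha> $ i + \<Delta>)) = ereal r"
  shows "coord_objective A \<phi> lam \<alpha> w i \<Delta> = ereal (- r - (column i A \<bullet> w) * \<Delta>
    - sqlen A i / (2 * lam * real CARD('n)) * \<Delta>\<^sup>2)"
  using assms by (simp add: coord_objective_def)

text \<open>The step 0 has a finite objective, so a maximiser cannot have objective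
  \<open>-\<infinity>\<close>.\<close>

lemma feasible_coord_update:
  assumes fin: "feasible \<alpha>"
    and max: "is_arg_max (coord_objective A \<phi> lam \<alpha> w i) (\<lambda>_. True) \<Delta>"
  shows "feasible (coord_update \<alpha> i \<Delta>)"
  unfolding feasible_def
proof
  fix j
  have "convex_conjugate (\<phi> i) (- (\<alpha> $ i + \<Delta>)) \<noteq> \<infinity>"
  proof
    assume "convex_conjugate (\<phi> i) (- (\<alpha> $ i + \<Delta>)) = \<infinity>"
    then have "coord_objective A \<phi> lam \<alpha> w i \<Delta> = -\<infinity>"
      by (simp add: coord_objective_def)
    moreover have "coord_objective A \<phi> lam \<alpha> w i 0 \<le> coord_objective A \<phi> lam \<alpha> w i \<Delta>"
      using max by (auto simp: is_arg_max_def not_less)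
    ultimately show False
      using coord_objective_finite[of i \<alpha> 0] feasible_conj_\<phi>[OF fin] by simp
  qed
  then show "convex_conjugate (\<phi> j) (- (coord_update \<alpha> i \<Delta> $ j)) \<noteq> \<infinity>"
    using fin by (auto simp: coord_update_def feasible_def)
qed

text \<open>Since the conjugate of \<open>g\<close> is 1-smooth, \<open>coord_objective\<close> is,
  up to an additive constant, a lower bound for \<open>CARD('n)\<close> times the dual increase.
  Hence the value of any trial step bounds the increase achieved by the maximiser.\<close>

lemma dual_increase:
  assumes fin: "feasible \<alpha>"
    and w: "GDERIV (\<lambda>u. real_of_ereal (convex_conjugate g u)) (dual_point \<alpha>) :> w"
    and max: "is_arg_max (coord_objective A \<phi> lam \<alpha> w i) (\<lambda>_. True) \<Delta>"
    and s: "s \<in> {0..1}"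
  shows "dual_real (coord_update \<alpha> i \<Delta>) - dual_real \<alpha>
    \<ge> (s * coord_gap \<alpha> w i + s * (residue A \<phi> \<alpha> w $ i)\<^sup>2 / 2 *
        (gam * (1 - s) - s * sqlen A i / (lam * real CARD('n)))) / real CARD('n)"
proof -
  define n where "n = real CARD('n)"
  define a where "a = column i A \<bullet> w"
  define v where "v = sqlen A i"
  define \<kappa> where "\<kappa> = residue A \<phi> \<alpha> w $ i"
  define q where "q = v / (2 * lam * n)"
  define c0 where "c0 = conj_\<phi> i (- (\<alpha> $ i))"
  define c1 where "c1 = conj_\<phi> i (- (\<alpha> $ i + \<Delta>))"
  have n: "n > 0" by (simp add: n_def)
  note fin' = feasible_coord_update[OF fin max]
  have c1: "convex_conjugate (\<phi> i) (- (\<alpha> $ i + \<Delta>)) = ereal c1"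
    using feasible_conj_\<phi>[OF fin', of i] by (simp add: coord_update_def c1_def)
  have c0: "convex_conjugate (\<phi> i) (- (\<alpha> $ i)) = ereal c0"
    using feasible_conj_\<phi>[OF fin, of i] by (simp add: c0_def)

  have \<kappa>: "- (\<alpha> $ i) - deriv (\<phi> i) a = - \<kappa>"
    by (simp add: \<kappa>_def a_def residue_def)
  \<comment> \<open>The trial step moves \<open>- (\<alpha> $ i)\<close> a fraction \<open>s\<close>
    of the way to \<open>deriv (\<phi> i) a\<close>, where the conjugate is known in closed
    form.\<close>
  have point: "- (\<alpha> $ i + - s * \<kappa>) = (1 - s) * (- (\<alpha> $ i)) + s * deriv (\<phi> i) a"
    by (simp add: \<kappa>_def a_def residue_def algebra_simps)
  define B where "B = (1 - s) * c0 + s * (a * deriv (\<phi> i) a - \<phi> i a) - gam / 2 * s * (1 - s) * \<kappa>\<^sup>2"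
  have trial: "convex_conjugate (\<phi> i) (- (\<alpha> $ i + - s * \<kappa>)) \<le> ereal B"
    using smooth_fun_conjugate_strongly_convex[OF smooth gam s c0
        convex_conjugate_deriv[OF convex smooth], of a]
    unfolding point B_def \<kappa> by simp
  then obtain r where r: "convex_conjugate (\<phi> i) (- (\<alpha> $ i + - s * \<kappa>)) = ereal r" "r \<le> B"
    by (metis conj_\<phi> ereal_infty_less_eq(1) ereal_less_eq(3) PInfty_neq_ereal(1))
  have "coord_objective A \<phi> lam \<alpha> w i (- s * \<kappa>) \<le> coord_objective A \<phi> lam \<alpha> w i \<Delta>"
    using max by (auto simp: is_arg_max_def not_less)
  then have "- r - a * (- s * \<kappa>) - q * (- s * \<kappa>)\<^sup>2 \<le> - c1 - a * \<Delta> - q * \<Delta>\<^sup>2"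
    unfolding coord_objective_finite[OF c1] coord_objective_finite[OF r(1)]
    by (simp add: a_def q_def v_def n_def)
  with r(2) have obj: "- B + a * s * \<kappa> - q * s\<^sup>2 * \<kappa>\<^sup>2 \<le> - c1 - a * \<Delta> - q * \<Delta>\<^sup>2"
    by (simp add: power_mult_distrib algebra_simps)

  have "conj_g (dual_point (coord_update \<alpha> i \<Delta>))
      \<le> conj_g (dual_point \<alpha>) + \<Delta> / (lam * n) * a + (\<Delta> / (lam * n))\<^sup>2 * v / 2"
    using strongly_convex_conjugate_gradient(1)[OF strongly_convex w]
      strongly_convex_conjugate_gradient(2)[OF strongly_convex w,
        of "(\<Delta> / (lam * n)) *\<^sub>R column i A"]
    unfolding dual_point_coord_update power2_norm_eq_inner
    by (simp add: conj_g n_def a_def v_def sqlen_def inner_commute power2_eq_square)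
  then have "lam * conj_g (dual_point (coord_update \<alpha> i \<Delta>))
      \<le> lam * (conj_g (dual_point \<alpha>) + \<Delta> / (lam * n) * a + (\<Delta> / (lam * n))\<^sup>2 * v / 2)"
    using lam by (intro mult_left_mono) auto
  \<comment> \<open>The smoothness term becomes exactly the quadratic penalty of the coordinate
    objective.\<close>
  also have "\<dots> = lam * conj_g (dual_point \<alpha>) + (a * \<Delta> + q * \<Delta>\<^sup>2) / n"
    using lam n by (simp add: q_def field_simps power2_eq_square)
  finally have "dual_real (coord_update \<alpha> i \<Delta>) - dual_real \<alpha>
      \<ge> (c0 - c1 - a * \<Delta> - q * \<Delta>\<^sup>2) / n"
    unfolding dual_real_eq[OF fin] dual_real_eq[OF fin']
      sum_coord_update[of "\<lambda>j x. conj_\<phi> j (- x)"]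
    by (simp add: c0_def c1_def n_def add_divide_distrib diff_divide_distrib)
  moreover have "(s * coord_gap \<alpha> w i + s * \<kappa>\<^sup>2 / 2 * (gam * (1 - s) - s * v / (lam * n))) / n
      \<le> (c0 - c1 - a * \<Delta> - q * \<Delta>\<^sup>2) / n"
  proof (rule divide_right_mono)
    have T: "coord_gap \<alpha> w i = \<phi> i a + c0 + (\<kappa> - deriv (\<phi> i) a) * a"
      by (simp add: coord_gap_def a_def c0_def \<kappa>_def residue_def)
    have "c0 - B + a * s * \<kappa> - q * s\<^sup>2 * \<kappa>\<^sup>2
      = s * coord_gap \<alpha> w i + s * \<kappa>\<^sup>2 / 2 * (gam * (1 - s) - s * v / (lam * n))"
      unfolding T B_def q_def using lam n by (simp add: field_simps power2_eq_square)
    with obj show "s * coord_gap \<alpha> w i + s * \<kappa>\<^sup>2 / 2 * (gam * (1 - s) - s * v / (lam * n))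
        \<le> c0 - c1 - a * \<Delta> - q * \<Delta>\<^sup>2"
      by simp
  qed (use n in simp)
  ultimately show ?thesis
    by (simp add: n_def v_def \<kappa>_def)
qed

section \<open>Sign and characterising equation of \<open>theta\<close>\<close>

lemma theta_denominator_pos:
  assumes "\<And>i. \<kappa> $ i \<noteq> 0 \<Longrightarrow> pmf q i > 0" and "\<kappa> \<noteq> 0"
  shows "(\<Sum>i | \<kappa> $ i \<noteq> 0.
      inverse (pmf q i) * \<bar>\<kappa> $ i\<bar>\<^sup>2 * (sqlen A i + real CARD('n) * lam * gam)) > 0"
proof (rule sum_pos)
  show "{i. \<kappa> $ i \<noteq> 0} \<noteq> {}" using assms(2) by (auto simp: vec_eq_iff)
  \<comment> \<open>A zero column has \<open>sqlen A i = 0\<close>; the second summand keeps the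
    factor positive.\<close>
  have "sqlen A i + real CARD('n) * lam * gam > 0" for i
    using lam gam by (simp add: sqlen_def add_nonneg_pos)
  then show "0 < inverse (pmf q i) * \<bar>\<kappa> $ i\<bar>\<^sup>2 * (sqlen A i + real CARD('n) * lam * gam)"
    if "i \<in> {i. \<kappa> $ i \<noteq> 0}" for i
    using that assms(1) by simp
qed simp

lemma theta_pos:
  assumes "\<And>i. \<kappa> $ i \<noteq> 0 \<Longrightarrow> pmf q i > 0" and "\<kappa> \<noteq> 0"
  shows "theta A lam gam \<kappa> q > 0"
  unfolding theta_def
proof (rule divide_pos_pos[OF mult_pos_pos theta_denominator_pos[OF assms]])
  show "(\<Sum>i | \<kappa> $ i \<noteq> 0. \<bar>\<kappa> $ i\<bar>\<^sup>2) > 0"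
    using assms(2) by (intro sum_pos) (auto simp: vec_eq_iff)
qed (use lam gam in simp)

lemma theta_0: "theta A lam gam 0 q = 0"
  by (simp add: theta_def)

text \<open>The equation that makes the quadratic terms of the trial steps cancel in expectation;
  for \<open>\<kappa> = 0\<close> both sides are 0.\<close>

lemma theta_mult_denominator:
  assumes "\<And>i. \<kappa> $ i \<noteq> 0 \<Longrightarrow> pmf q i > 0"
  shows "theta A lam gam \<kappa> q * (\<Sum>i | \<kappa> $ i \<noteq> 0.
      inverse (pmf q i) * \<bar>\<kappa> $ i\<bar>\<^sup>2 * (sqlen A i + real CARD('n) * lam * gam))
    = real CARD('n) * lam * gam * (\<Sum>i | \<kappa> $ i \<noteq> 0. \<bar>\<kappa> $ i\<bar>\<^sup>2)"
proof (cases "\<kappa> = 0")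
  case False
  from theta_denominator_pos[OF assms this] show ?thesis
    unfolding theta_def by (subst nonzero_eq_divide_eq[symmetric]) auto
qed simp

lemma expected_dual_increase:
  assumes fin: "feasible \<alpha>"
    and w: "GDERIV (\<lambda>u. real_of_ereal (convex_conjugate g u)) (dual_point \<alpha>) :> w"
    and q_pos: "\<And>i. residue A \<phi> \<alpha> w $ i \<noteq> 0 \<Longrightarrow> pmf q i > 0"
    and theta_le: "\<And>i. residue A \<phi> \<alpha> w $ i \<noteq> 0
      \<Longrightarrow> theta A lam gam (residue A \<phi> \<alpha> w) q \<le> pmf q i"
    and run: "\<And>i. i \<in> set_pmf q \<Longrightarrow> \<exists>\<Delta>.
      is_arg_max (coord_objective A \<phi> lam \<alpha> w i) (\<lambda>_. True) \<Delta> \<and> \<alpha>' i = coord_update \<alpha> i \<Delta>"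
  shows "(\<Sum>i\<in>UNIV. pmf q i * dual_real (\<alpha>' i))
    \<ge> dual_real \<alpha> + theta A lam gam (residue A \<phi> \<alpha> w) q * gap A \<phi> g lam \<alpha> w"
proof -
  define n where "n = real CARD('n)"
  define \<kappa> where "\<kappa> = residue A \<phi> \<alpha> w"
  define \<theta> where "\<theta> = theta A lam gam \<kappa> q"
  define T where "T = coord_gap \<alpha> w"
  define I where "I = {i. \<kappa> $ i \<noteq> 0}"
  \<comment> \<open>On \<open>I\<close> the product \<open>pmf q i * s i\<close> is \<theta>, so all
    coordinate gaps receive the same weight. Off \<open>I\<close> the residue is 0 and the choice 0
    avoids dividing by a probability that may vanish.\<close>
  define s where "s i = (if i \<in> I then \<theta> / pmf q i else 0)" for i
  \<comment> \<open>Up to the factor \<open>\<theta> * gam / (2 * n)\<close>, the quadratic part of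
    the bound for coordinate \<open>i\<close>, weighted by its probability.\<close>
  define R where "R i = (\<kappa> $ i)\<^sup>2 - \<theta> * (inverse (pmf q i) * \<bar>\<kappa> $ i\<bar>\<^sup>2 *
      (sqlen A i + n * lam * gam)) / (n * lam * gam)" for i
  have n: "n > 0" by (simp add: n_def)
  have q_pos: "pmf q i > 0" "\<theta> \<le> pmf q i" if "i \<in> I" for i
    using that q_pos theta_le by (auto simp: I_def \<kappa>_def \<theta>_def)
  have "\<theta> \<ge> 0"
    using theta_pos[of \<kappa> q] theta_0[of q] q_pos(1)
    by (cases "\<kappa> = 0") (auto simp: \<theta>_def I_def intro: less_imp_le)
  then have s: "s i \<in> {0..1}" for i
    using q_pos[of i] by (simp add: s_def)
  have step: "pmf q i * (dual_real (\<alpha>' i) - dual_real \<alpha>)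
      \<ge> (if i \<in> I then (\<theta> * T i + \<theta> * gam / 2 * R i) / n else 0)" for i
  proof (cases "i \<in> set_pmf q")
    case False
    \<comment> \<open>Nothing is known about \<open>\<alpha>' i\<close> here, but its weight is 0
      and so is the claimed bound.\<close>
    then have "i \<notin> I" "pmf q i = 0" using q_pos(1)[of i] by (auto simp: set_pmf_iff)
    then show ?thesis by simp
  next
    case True
    then obtain \<Delta> where "is_arg_max (coord_objective A \<phi> lam \<alpha> w i) (\<lambda>_. True) \<Delta>"
      "\<alpha>' i = coord_update \<alpha> i \<Delta>"
      using run by blast
    then have "dual_real (\<alpha>' i) - dual_real \<alpha> \<ge> (s i * T i + s i * (\<kappa> $ i)\<^sup>2 / 2 *
        (gam * (1 - s i) - s i * sqlen A i / (lam * n))) / n"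
      using dual_increase[OF fin w _ s[of i]] by (simp add: T_def \<kappa>_def n_def)
    then have "pmf q i * (dual_real (\<alpha>' i) - dual_real \<alpha>)
      \<ge> pmf q i * ((s i * T i + s i * (\<kappa> $ i)\<^sup>2 / 2 *
        (gam * (1 - s i) - s i * sqlen A i / (lam * n))) / n)"
      by (intro mult_left_mono) auto
    moreover have "pmf q i * ((s i * T i + s i * (\<kappa> $ i)\<^sup>2 / 2 *
        (gam * (1 - s i) - s i * sqlen A i / (lam * n))) / n)
      = (\<theta> * T i + \<theta> * gam / 2 * R i) / n" if "i \<in> I"
      using q_pos(1)[OF that] that n lam gam unfolding s_def R_def
      by (simp add: field_simps power2_eq_square)
    ultimately show ?thesis
      by (cases "i \<in> I") (simp_all only: if_True if_False, simp add: s_def)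
  qed
  have "(\<Sum>i\<in>I. R i) = (\<Sum>i\<in>I. \<bar>\<kappa> $ i\<bar>\<^sup>2) - \<theta> * (\<Sum>i\<in>I. inverse (pmf q i) * \<bar>\<kappa> $ i\<bar>\<^sup>2 *
      (sqlen A i + n * lam * gam)) / (n * lam * gam)"
    by (simp add: R_def sum_subtractf sum_distrib_left sum_divide_distrib)
  also have "\<dots> = 0"
    unfolding I_def \<theta>_def n_def using lam gam q_pos(1)
    by (subst theta_mult_denominator) (auto simp: I_def)
  finally have R: "(\<Sum>i\<in>I. R i) = 0" .
  \<comment> \<open>A coordinate with zero residue has zero gap, so \<open>I\<close> already carries
    the whole duality gap.\<close>
  have T: "(\<Sum>i\<in>I. T i) = (\<Sum>i\<in>UNIV. T i)"
    by (intro sum.mono_neutral_left) (auto simp: I_def T_def \<kappa>_def intro: coord_gap_eq_0)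
  have "\<theta> * gap A \<phi> g lam \<alpha> w = (\<theta> * (\<Sum>i\<in>I. T i) + \<theta> * gam / 2 * (\<Sum>i\<in>I. R i)) / n"
    unfolding gap_eq[OF fin w, folded T_def n_def] by (simp add: R T)
  also have "\<dots> = (\<Sum>i\<in>I. (\<theta> * T i + \<theta> * gam / 2 * R i) / n)"
    by (simp add: sum_distrib_left sum_divide_distrib sum.distrib add_divide_distrib)
  also have "\<dots> = (\<Sum>i\<in>UNIV. if i \<in> I then (\<theta> * T i + \<theta> * gam / 2 * R i) / n else 0)"
    by (simp add: sum.If_cases)
  also have "\<dots> \<le> (\<Sum>i\<in>UNIV. pmf q i * (dual_real (\<alpha>' i) - dual_real \<alpha>))"
    by (intro sum_mono step)
  also have "\<dots> = (\<Sum>i\<in>UNIV. pmf q i * dual_real (\<alpha>' i)) - dual_real \<alpha>"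
    by (simp add: right_diff_distrib sum_subtractf sum_distrib_right[symmetric] sum_pmf_eq_1)
  finally show ?thesis by (simp add: \<theta>_def \<kappa>_def)
qed

section \<open>Invariants along a run\<close>

lemma run_invariant:
  assumes run: "adasdca_run A \<phi> g lam \<alpha>0 p \<alpha> abar w"
    and "feasible \<alpha>0" and "h \<in> set_pmf (past p k)"
  shows "feasible (\<alpha> h) \<and> abar h = dual_point (\<alpha> h)"
  using assms(3)
proof (induction k arbitrary: h)
  case 0
  then show ?case
    using run assms(2)
    by (simp add: adasdca_run_def dual_point_def matrix_mult_sum scalar_mult_eq_scaleR)
next
  case (Suc k)
  then obtain h' i where h': "h' \<in> set_pmf (past p k)" and i: "i \<in> set_pmf (p h')"
    and h: "h = h' @ [i]"
    by auto
  from run h' i obtain \<Delta> where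
    max: "is_arg_max (coord_objective A \<phi> lam (\<alpha> h') (w h') i) (\<lambda>_. True) \<Delta>"
    and "\<alpha> h = coord_update (\<alpha> h') i \<Delta>"
    and "abar h = abar h' + (\<Delta> / (lam * real CARD('n))) *\<^sub>R column i A"
    unfolding adasdca_run_def coord_update_def h by blast
  with Suc.IH[OF h'] show ?case
    by (simp add: dual_point_coord_update feasible_coord_update[OF _ max])
qed

lemma gap_nonneg:
  assumes "feasible \<alpha>"
  shows "gap A \<phi> g lam \<alpha> w \<ge> 0"
  using weak_duality[OF assms] by (simp add: gap_def dual_real_def)

text \<open>Used in contrapositive form: a positive gap forces a nonzero residue and hence a
  positive \<open>theta\<close>.\<close>

lemma gap_eq_0_if_residue_eq_0:
  assumes "feasible \<alpha>"
    and "GDERIV (\<lambda>u. real_of_ereal (convex_conjugate g u)) (dual_point \<alpha>) :> w"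
    and "residue A \<phi> \<alpha> w = 0"
  shows "gap A \<phi> g lam \<alpha> w = 0"
  unfolding gap_eq[OF assms(1,2)] by (simp add: coord_gap_eq_0 assms(3))

end

section \<open>Expectations along a run\<close>

text \<open>Makes every real function of the history integrable and every expectation a finite
  sum.\<close>

lemma finite_set_pmf_past:
  fixes p :: "'n::finite list \<Rightarrow> 'n pmf"
  shows "finite (set_pmf (past p k))"
  by (induction k) auto

text \<open>The tower rule: condition on the history before the last draw.\<close>

lemma expectation_past_Suc:
  fixes p :: "'n::finite list \<Rightarrow> 'n pmf" and f :: "'n list \<Rightarrow> real"
  shows "measure_pmf.expectation (past p (Suc k)) f
    = measure_pmf.expectation (past p k) (\<lambda>h. \<Sum>i\<in>UNIV. pmf (p h) i * f (h @ [i]))"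
proof -
  have "measure_pmf.expectation (map_pmf (\<lambda>i. h @ [i]) (p h)) f
      = (\<Sum>i\<in>UNIV. pmf (p h) i * f (h @ [i]))" for h
    by (simp add: integral_measure_pmf[of UNIV])
  then show ?thesis
    by (simp add: pmf_expectation_bind[OF finite_set_pmf_past[of p k]]
        integral_measure_pmf[OF finite_set_pmf_past[of p k]])
qed

theorem theorem7:
  fixes A :: "real^'n^'d"
    and \<phi> :: "'n \<Rightarrow> real \<Rightarrow> real"
    and g :: "real^'d \<Rightarrow> real"
    and lam gam :: real
    and \<alpha>0 \<alpha>star :: "real^'n"
    and p :: "'n list \<Rightarrow> 'n pmf"
    and \<alpha> :: "'n list \<Rightarrow> real^'n"
    and abar w :: "'n list \<Rightarrow> real^'d"
    and t :: nat
  assumes "lam > 0" and "gam > 0"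
    and "\<And>i. convex_on UNIV (\<phi> i)"
    and "\<And>i. smooth_fun (1 / gam) (\<phi> i)"
    and "strongly_convex 1 g"
    and "dual A \<phi> g lam \<alpha>0 > -\<infinity>"
    and "adasdca_run A \<phi> g lam \<alpha>0 p \<alpha> abar w"
    and "\<And>k h. h \<in> set_pmf (past p k) \<Longrightarrow>
           min_prob (residue A \<phi> (\<alpha> h) (w h)) (p h) > 0"
    and "\<And>k h. h \<in> set_pmf (past p k) \<Longrightarrow>
           ereal (theta A lam gam (residue A \<phi> (\<alpha> h) (w h)) (p h))
             \<le> min_prob (residue A \<phi> (\<alpha> h) (w h)) (p h)"
    and "is_arg_max (dual A \<phi> g lam) (\<lambda>_. True) \<alpha>star"
    and "\<And>k. k \<le> t \<Longrightarrow> expected_gap A \<phi> g lam p \<alpha> w k > 0"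
  shows "expected_gap A \<phi> g lam p \<alpha> w t
    \<le> 1 / theta_tilde A \<phi> g lam gam p \<alpha> w t
       * (\<Prod>k<t. 1 - theta_tilde A \<phi> g lam gam p \<alpha> w k)
       * (real_of_ereal (dual A \<phi> g lam \<alpha>star) - real_of_ereal (dual A \<phi> g lam \<alpha>0))"
proof -
  interpret dual_ascent A \<phi> g lam gam
    using assms(1-5) by unfold_locales
  let ?E = "\<lambda>k. measure_pmf.expectation (past p k)"
  define \<kappa> where "\<kappa> h = residue A \<phi> (\<alpha> h) (w h)" for h
  define \<theta> where "\<theta> h = theta A lam gam (\<kappa> h) (p h)" for h
  define G where "G h = gap A \<phi> g lam (\<alpha> h) (w h)" for h
  define D where "D h = dual_real (\<alpha> h)" for h
  define \<Theta> where "\<Theta> = theta_tilde A \<phi> g lam gam p \<alpha> w"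
  define \<epsilon> where "\<epsilon> k = dual_real \<alpha>star - ?E k D" for k
  note run = assms(7)
  have int: "integrable (measure_pmf (past p k)) f" for k and f :: "'n list \<Rightarrow> real"
    by (rule integrable_measure_pmf_finite[OF finite_set_pmf_past])
  have mono: "?E k f1 \<le> ?E k f2" if "\<And>h. h \<in> set_pmf (past p k) \<Longrightarrow> f1 h \<le> f2 h"
    for k and f1 f2 :: "'n list \<Rightarrow> real"
    using that by (intro integral_mono_AE int) (simp add: AE_measure_pmf_iff)

  note feasible0 = feasible_if_dual_finite[OF assms(6)]
  note inv = run_invariant[OF run feasible0]
  have max: "dual A \<phi> g lam \<beta> \<le> dual A \<phi> g lam \<alpha>star" for \<beta>
    using assms(10) by (auto simp: is_arg_max_def not_less)
  then have feasible_star: "feasible \<alpha>star"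
    using assms(6) by (intro feasible_if_dual_finite) (metis order_less_le_trans)
  have D_le: "D h \<le> dual_real \<alpha>star" if "h \<in> set_pmf (past p k)" for h k
    using max[of "\<alpha> h"] inv[OF that] feasible_star
    by (simp add: D_def dual_eq dual_real_eq)
  have grad: "GDERIV (\<lambda>u. real_of_ereal (convex_conjugate g u)) (dual_point (\<alpha> h)) :> w h"
    if "h \<in> set_pmf (past p k)" for h k
    using run that inv[OF that] unfolding adasdca_run_def by metis
  have p_pos: "pmf (p h) i > 0" and \<theta>_le: "\<theta> h \<le> pmf (p h) i"
    if "h \<in> set_pmf (past p k)" "\<kappa> h $ i \<noteq> 0" for h k i
  proof -
    have "min_prob (\<kappa> h) (p h) \<le> ereal (pmf (p h) i)"
      unfolding min_prob_def using that(2) by (intro INF_lower) simp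
    then show "pmf (p h) i > 0" "\<theta> h \<le> pmf (p h) i"
      using assms(8,9)[OF that(1)] unfolding \<theta>_def \<kappa>_def
      by (metis ereal_less(2) order_less_le_trans, metis ereal_less_eq(3) order_trans)
  qed
  \<comment> \<open>For a zero residue \<open>min_prob\<close> is \<infinity> and bounds nothing;
    the convention for \<open>theta\<close> at 0 covers that case.\<close>
  have \<theta>_le_1: "\<theta> h \<le> 1" if "h \<in> set_pmf (past p k)" for h k
  proof (cases "\<kappa> h = 0")
    case False
    then obtain i where "\<kappa> h $ i \<noteq> 0" by (metis vec_eq_iff zero_index)
    then show ?thesis using \<theta>_le[OF that] pmf_le_1[of "p h" i] by force
  qed (simp add: \<theta>_def theta_0)
  have G_nonneg: "G h \<ge> 0" if "h \<in> set_pmf (past p k)" for h k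
    using inv[OF that] by (simp add: G_def gap_nonneg)
  have \<theta>_pos: "\<theta> h > 0" if "h \<in> set_pmf (past p k)" "G h > 0" for h k
  proof -
    have "\<kappa> h \<noteq> 0"
      using gap_eq_0_if_residue_eq_0[OF _ grad[OF that(1)]] inv[OF that(1)] that(2)
      by (auto simp: G_def \<kappa>_def)
    then show ?thesis
      unfolding \<theta>_def using p_pos[OF that(1)] by (intro theta_pos)
  qed

  \<comment> \<open>The averaged coefficients lie between 0 and 1\<close>
  have gap_pos: "?E k G > 0" if "k \<le> t" for k
    using assms(11)[OF that] by (simp add: expected_gap_def G_def[abs_def])
  \<comment> \<open>As \<theta> varies with the history, it cannot simply leave the expectation;
    \<Theta> is its gap-weighted mean.\<close>
  have \<Theta>_eq: "\<Theta> k * ?E k G = ?E k (\<lambda>h. \<theta> h * G h)" if "k \<le> t" for k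
    using gap_pos[OF that]
    by (simp add: \<Theta>_def theta_tilde_def expected_gap_def \<theta>_def \<kappa>_def G_def[abs_def])
  have \<Theta>_le_1: "\<Theta> k \<le> 1" if "k \<le> t" for k
  proof -
    have "?E k (\<lambda>h. \<theta> h * G h) \<le> ?E k G"
      using mult_right_mono[OF \<theta>_le_1 G_nonneg] by (intro mono) simp
    then show ?thesis
      unfolding \<Theta>_eq[OF that, symmetric]
      using gap_pos[OF that] mult_right_le_imp_le[of "\<Theta> k" "?E k G" 1] by simp
  qed
  have \<Theta>_pos: "\<Theta> k > 0" if "k \<le> t" for k
  proof -
    have "\<exists>h\<in>set_pmf (past p k). G h > 0"
    proof (rule ccontr)
      assume "\<not> ?thesis"
      then have "?E k G \<le> ?E k (\<lambda>_. 0)" by (intro mono) (auto simp: not_less)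
      with gap_pos[OF that] show False by simp
    qed
    then obtain h where h: "h \<in> set_pmf (past p k)" "G h > 0" by blast
    \<comment> \<open>Histories with zero gap contribute 0, and those with positive gap have
      positive \<theta>; \<open>h\<close> is one of the latter.\<close>
    have "0 < (\<Sum>h\<in>set_pmf (past p k). \<theta> h * G h * pmf (past p k) h)"
    proof (rule sum_pos2[OF finite_set_pmf_past h(1)])
      show "0 < \<theta> h * G h * pmf (past p k) h"
        using h \<theta>_pos[OF h] by (simp add: pmf_positive)
      show "0 \<le> \<theta> h' * G h' * pmf (past p k) h'" if "h' \<in> set_pmf (past p k)" for h'
        using G_nonneg[OF that] \<theta>_pos[OF that] by (cases "G h' = 0") auto
    qed
    then have "?E k (\<lambda>h. \<theta> h * G h) > 0"
      by (subst integral_measure_pmf_real[OF finite_set_pmf_past[of p k]]) auto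
    then show ?thesis
      using \<Theta>_eq[OF that] gap_pos[OF that] by (metis zero_less_mult_pos2)
  qed

  \<comment> \<open>Contraction of the expected dual suboptimality\<close>
  have step: "?E (Suc k) D \<ge> ?E k D + ?E k (\<lambda>h. \<theta> h * G h)" for k
  proof -
    have "?E k D + ?E k (\<lambda>h. \<theta> h * G h) = ?E k (\<lambda>h. D h + \<theta> h * G h)"
      by (rule Bochner_Integration.integral_add[symmetric, OF int int])
    also have "\<dots> \<le> ?E k (\<lambda>h. \<Sum>i\<in>UNIV. pmf (p h) i * D (h @ [i]))"
    proof (rule mono)
      fix h assume h: "h \<in> set_pmf (past p k)"
      show "D h + \<theta> h * G h \<le> (\<Sum>i\<in>UNIV. pmf (p h) i * D (h @ [i]))"
        unfolding D_def \<theta>_def G_def \<kappa>_def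
      proof (rule expected_dual_increase)
        fix i assume "i \<in> set_pmf (p h)"
        then show "\<exists>\<Delta>. is_arg_max (coord_objective A \<phi> lam (\<alpha> h) (w h) i) (\<lambda>_. True) \<Delta> \<and>
            \<alpha> (h @ [i]) = coord_update (\<alpha> h) i \<Delta>"
          using run h unfolding adasdca_run_def coord_update_def by blast
      qed (use inv[OF h] grad[OF h] p_pos[OF h] \<theta>_le[OF h] in \<open>auto simp: \<theta>_def \<kappa>_def\<close>)
    qed
    finally show ?thesis by (simp only: expectation_past_Suc)
  qed
  have \<epsilon>_nonneg: "\<epsilon> k \<ge> 0" for k
    using mono[of k D "\<lambda>_. dual_real \<alpha>star"] D_le by (simp add: \<epsilon>_def)
  \<comment> \<open>Weak duality at \<open>\<alpha>star\<close> bounds the suboptimality by the gap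
    on each history.\<close>
  have \<epsilon>_le: "\<epsilon> k \<le> ?E k G" for k
  proof -
    have "?E k (\<lambda>h. dual_real \<alpha>star - D h) \<le> ?E k G"
      using weak_duality[OF feasible_star]
      by (intro mono) (simp add: G_def D_def gap_def dual_real_def)
    then show ?thesis by (simp add: \<epsilon>_def int)
  qed
  have contraction: "\<epsilon> (Suc k) \<le> (1 - \<Theta> k) * \<epsilon> k" if "k \<le> t" for k
  proof -
    have "\<epsilon> (Suc k) \<le> \<epsilon> k - \<Theta> k * ?E k G"
      using step[of k] \<Theta>_eq[OF that] by (simp add: \<epsilon>_def)
    also have "\<dots> \<le> \<epsilon> k - \<Theta> k * \<epsilon> k"
      using \<epsilon>_le[of k] \<Theta>_pos[OF that] by simp
    finally show ?thesis by (simp add: algebra_simps)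
  qed
  have "\<epsilon> k \<le> (\<Prod>j<k. 1 - \<Theta> j) * \<epsilon> 0" if "k \<le> t" for k
    using that
  proof (induction k)
    case (Suc k)
    then have "\<epsilon> (Suc k) \<le> (1 - \<Theta> k) * \<epsilon> k" by (intro contraction) simp
    also have "\<dots> \<le> (1 - \<Theta> k) * ((\<Prod>j<k. 1 - \<Theta> j) * \<epsilon> 0)"
      using Suc \<Theta>_le_1[of k] by (intro mult_left_mono) auto
    finally show ?case by (simp add: mult_ac)
  qed simp
  \<comment> \<open>One iteration beyond \<open>t\<close>: the dual progress it makes cannot exceed
    the suboptimality left at \<open>t\<close>.\<close>
  moreover have "\<Theta> t * ?E t G \<le> \<epsilon> t"
    using step[of t] \<Theta>_eq[of t] \<epsilon>_nonneg[of "Suc t"] by (simp add: \<epsilon>_def)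
  ultimately have "\<Theta> t * ?E t G \<le> (\<Prod>j<t. 1 - \<Theta> j) * \<epsilon> 0"
    by (meson order_refl order_trans)
  then have "?E t G \<le> 1 / \<Theta> t * (\<Prod>j<t. 1 - \<Theta> j) * \<epsilon> 0"
    using \<Theta>_pos[of t] by (simp add: field_simps)
  moreover have "\<epsilon> 0 = real_of_ereal (dual A \<phi> g lam \<alpha>star) - real_of_ereal (dual A \<phi> g lam \<alpha>0)"
    using run by (simp add: \<epsilon>_def D_def dual_real_def adasdca_run_def)
  ultimately show ?thesis
    by (simp add: \<Theta>_def expected_gap_def G_def[abs_def])
qed

end
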